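(* Let $\langle X_\alpha:\alpha\in I\rangle$ be a family of $T_0$ topological spaces. Then $$\operatorname{sm}\Big(\sum_{\alpha\in I}X_\alpha\Big)\le\Big(\sup_{\alpha\in I}\operatorname{sm}(X_\alpha)\Big)\oplus 1,$$ where $\sum_{\alpha\in I}X_\alpha$ is the topological sum (disjoint union) and $\oplus$ is ordinal addition.
   Context: Set membership game $G_\beta(Y,X)$ ($X$ a topological space, $Y\subseteq X$, $\beta$ an ordinal): two players, Seeker and Hider, make $\beta$ moves. At move $\alpha<\beta$, knowing all previous moves, the Seeker chooses an open set $U_\alpha\subseteq X$, and then the Hider chooses $V_\alpha\in\{U_\alpha, X\setminus U_\alpha\}$. The outcome is $W=\bigcap_{\alpha<\beta}V_\alpha$ (with $W=X$ if $\beta=0$). The Seeker wins iff $W\subseteq Y$ or $W\cap Y=\emptyset$. For a $T_0$ space $X$: $\operatorname{sm}(Y,X)$ is the least ordinal $\beta$ such that the Seeker has a winning strategy in $G_\beta(Y,X)$, and $\operatorname{sm}(X)=\sup\{\operatorname{sm}(Y,X):Y\subseteq X\}$ (an ordinal). *)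

theory Defs
  imports "HOL-Analysis.Analysis"
begin

unbundle cardinal_syntax
no_notation elt_set_eq (infix \<open>=o\<close> 50)

section \<open>Ordinals as well-orders\<close>

text \<open>
  An ordinal is represented by a well-order \<^term>\<open>r\<close> (a reflexive relation, possibly on a proper
  subset \<^term>\<open>Field r\<close> of its type), so \<^term>\<open>{}\<close> is the ordinal zero. Ordinals are compared by
  \<open>\<le>o\<close>, \<open><o\<close> and \<open>=o\<close>, which relate well-orders on different types.
\<close>

definition oleast :: "('o rel \<Rightarrow> bool) \<Rightarrow> 'o rel" where
  "oleast P = (SOME r. Well_order r \<and> P r \<and> (\<forall>s. Well_order s \<and> P s \<longrightarrow> r \<le>o s))"

text \<open>
  The supremum is sought among the well-orders on the same type; if there is an upper bound on
  that type, it is also the supremum among the well-orders on all types (\<open>osup_least\<close>).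
\<close>

definition osup :: "'o rel set \<Rightarrow> 'o rel" where
  "osup R = oleast (\<lambda>s. \<forall>r\<in>R. r \<le>o s)"

definition osum :: "'o rel \<Rightarrow> 'p rel \<Rightarrow> ('o + 'p) rel" (infixl \<open>\<oplus>o\<close> 65) where
  "r \<oplus>o s = {(Inl a, Inl b) | a b. (a, b) \<in> r} \<union> {(Inr c, Inr d) | c d. (c, d) \<in> s}
           \<union> {(Inl a, Inr d) | a d. a \<in> Field r \<and> d \<in> Field s}"

definition oone :: "unit rel" where
  "oone = {((), ())}"


section \<open>The set membership game\<close>

text \<open>
  For a game of length \<^term>\<open>r\<close> the moves are indexed by \<^term>\<open>Field r\<close>. A play \<^term>\<open>p\<close> assigns to
  a move the pair consisting of the Seeker's choice and the Hider's answer. A strategy of the Seeker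
  gets the index of the move and the record of all previous moves, which is the play restricted
  to \<^term>\<open>underS r a\<close> (and \<^term>\<open>undefined\<close> elsewhere).
\<close>

type_synonym ('o, 'a) play = "'o \<Rightarrow> 'a set \<times> 'a set"
type_synonym ('o, 'a) strategy = "'o \<Rightarrow> ('o, 'a) play \<Rightarrow> 'a set"

definition legal_play :: "'o rel \<Rightarrow> 'a topology \<Rightarrow> ('o, 'a) play \<Rightarrow> bool" where
  "legal_play r X p \<longleftrightarrow>
     (\<forall>a\<in>Field r. openin X (fst (p a)) \<and> snd (p a) \<in> {fst (p a), topspace X - fst (p a)})"

definition follows :: "'o rel \<Rightarrow> ('o, 'a) strategy \<Rightarrow> ('o, 'a) play \<Rightarrow> bool" where
  "follows r \<sigma> p \<longleftrightarrow> (\<forall>a\<in>Field r. fst (p a) = \<sigma> a (restrict p (underS r a)))"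

definition outcome :: "'o rel \<Rightarrow> 'a topology \<Rightarrow> ('o, 'a) play \<Rightarrow> 'a set" where
  "outcome r X p = topspace X \<inter> (\<Inter>a\<in>Field r. snd (p a))"

text \<open>
  Strategies are total functions, so they are required to return an open set on all records, also
  on those that do not occur in a play; this is no restriction.
\<close>

definition seeker_wins :: "'o rel \<Rightarrow> 'a topology \<Rightarrow> 'a set \<Rightarrow> bool" where
  "seeker_wins r X Y \<longleftrightarrow>
     (\<exists>\<sigma>. (\<forall>a h. openin X (\<sigma> a h)) \<and>
          (\<forall>p. legal_play r X p \<and> follows r \<sigma> p \<longrightarrow>
               outcome r X p \<subseteq> Y \<or> outcome r X p \<inter> Y = {}))"

text \<open>
  For a \<open>T\<^sub>0\<close> space on the type \<^typ>\<open>'a\<close> the Seeker wins by playing all open sets, so the well-orders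
  on \<^typ>\<open>'a set\<close> are long enough. The least one among them is then least among all ordinals
  (\<open>sm_at_least\<close>), and the same holds for the supremum (\<open>sm_least\<close>).
\<close>

definition sm_at :: "'a topology \<Rightarrow> 'a set \<Rightarrow> 'a set rel" where
  "sm_at X Y = oleast (\<lambda>r. seeker_wins r X Y)"

definition sm :: "'a topology \<Rightarrow> 'a set rel" where
  "sm X = osup {sm_at X Y | Y. Y \<subseteq> topspace X}"


section \<open>Well-definedness\<close>

lemma oleast_works:
  fixes P :: "'o rel \<Rightarrow> bool"
  assumes "Well_order t" "P t"
  shows "Well_order (oleast P)" "P (oleast P)"
    "\<And>s. Well_order s \<Longrightarrow> P s \<Longrightarrow> oleast P \<le>o s"
proof -
  have "\<exists>r. Well_order r \<and> P r \<and> (\<forall>s. Well_order s \<and> P s \<longrightarrow> r \<le>o s)"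
  proof -
    obtain m where m: "m \<in> {r. Well_order r \<and> P r}"
      "\<And>y. (y, m) \<in> ordLess \<Longrightarrow> y \<notin> {r. Well_order r \<and> P r}"
      using wfE_min[OF wf_ordLess, of t "{r. Well_order r \<and> P r}"] assms by blast
    have "m \<le>o s" if "Well_order s" "P s" for s
      using m that ordLess_or_ordLeq[of s m] by blast
    with m show ?thesis by blast
  qed
  from someI_ex[OF this] show "Well_order (oleast P)" "P (oleast P)"
    "\<And>s. Well_order s \<Longrightarrow> P s \<Longrightarrow> oleast P \<le>o s"
    unfolding oleast_def by blast+
qed

lemma oleast_least:
  fixes P :: "'o rel \<Rightarrow> bool" and t :: "'p rel"
  assumes t0: "Well_order t0" "P t0" and t: "Well_order t"
    and "\<And>s::'o rel. s =o t \<Longrightarrow> P s"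
  shows "oleast P \<le>o t"
proof (rule ccontr)
  assume "\<not> oleast P \<le>o t"
  then have lt: "t <o oleast P"
    using oleast_works(1)[of t0 P, OF t0] t ordLess_or_ordLeq by blast
  then obtain s :: "'o rel" where s: "t =o s" "s <o oleast P"
    using internalize_ordLess[of t "oleast P"] by blast
  have "P s" using assms(4) s(1) ordIso_symmetric by blast
  then have "oleast P \<le>o s"
    using oleast_works(3)[of t0 P, OF t0] s(2) unfolding ordLess_def by blast
  then show False using s(2) not_ordLess_ordLeq by blast
qed

lemma osup_upper:
  fixes t :: "'o rel" and R :: "'o rel set"
  assumes "Well_order t" "\<And>r. r \<in> R \<Longrightarrow> r \<le>o t"
  shows "Well_order (osup R)" "\<And>r. r \<in> R \<Longrightarrow> r \<le>o osup R"
  using oleast_works(1,2)[of t "\<lambda>s. \<forall>r\<in>R. r \<le>o s"] assms unfolding osup_def by blast+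

lemma osup_least:
  fixes t0 :: "'o rel" and t :: "'p rel" and R :: "'o rel set"
  assumes "Well_order t0" "\<And>r. r \<in> R \<Longrightarrow> r \<le>o t0"
    and "Well_order t" "\<And>r. r \<in> R \<Longrightarrow> r \<le>o t"
  shows "osup R \<le>o t"
  unfolding osup_def
proof (rule oleast_least[of t0])
  show "\<forall>r\<in>R. r \<le>o s" if "s =o t" for s :: "'o rel"
    using assms(4) ordLeq_ordIso_trans[OF _ ordIso_symmetric[OF that]] by auto
qed (use assms in auto)

lemma seeker_wins_ordIso:
  assumes "r =o t" and "seeker_wins r X Y"
  shows "seeker_wins t X Y"
proof -
  from assms(1) obtain f where wo: "Well_order r" "Well_order t" and f: "iso r t f"
    unfolding ordIso_def by blast
  have bij: "bij_betw f (Field r) (Field t)" using f unfolding iso_def by blast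
  then have inj: "inj_on f (Field r)" and im: "f ` Field r = Field t"
    unfolding bij_betw_def by auto
  have emb: "f ` underS r a = underS t (f a)" if "a \<in> Field r" for a
    using embed_underS[of r t f a] that wo f unfolding iso_def bij_betw_def by auto
  obtain \<sigma> where op: "\<And>a h. openin X (\<sigma> a h)"
    and win: "\<And>p. legal_play r X p \<Longrightarrow> follows r \<sigma> p \<Longrightarrow>
               outcome r X p \<subseteq> Y \<or> outcome r X p \<inter> Y = {}"
    using assms(2) unfolding seeker_wins_def by blast
  define g where "g = inv_into (Field r) f"
  define \<tau> where "\<tau> = (\<lambda>b h. \<sigma> (g b) (restrict (\<lambda>a. h (f a)) (underS r (g b))))"
  have "outcome t X p \<subseteq> Y \<or> outcome t X p \<inter> Y = {}"
    if lp: "legal_play t X p" and fo: "follows t \<tau> p" for p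
  proof -
    have "legal_play r X (\<lambda>a. p (f a))"
      using lp im unfolding legal_play_def by blast
    moreover have "follows r \<sigma> (\<lambda>a. p (f a))"
      unfolding follows_def
    proof
      fix a assume a: "a \<in> Field r"
      have g: "g (f a) = a" unfolding g_def using inj a by simp
      have eq: "restrict (\<lambda>a'. restrict p (underS t (f a)) (f a')) (underS r a)
            = restrict (\<lambda>a. p (f a)) (underS r a)"
        using emb[OF a] by (auto simp: restrict_def fun_eq_iff)
      have "fst (p (f a)) = \<tau> (f a) (restrict p (underS t (f a)))"
        using fo a im unfolding follows_def by blast
      then show "fst (p (f a)) = \<sigma> a (restrict (\<lambda>a. p (f a)) (underS r a))"
        unfolding \<tau>_def g eq .
    qed
    moreover have "outcome r X (\<lambda>a. p (f a)) = outcome t X p"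
      unfolding outcome_def im[symmetric] by simp
    ultimately show ?thesis using win by metis
  qed
  then show ?thesis
    unfolding seeker_wins_def using op by (intro exI[of _ \<tau>]) (auto simp: \<tau>_def)
qed

lemma seeker_wins_opens:
  assumes "t0_space X"
  shows "seeker_wins (card_of {U. openin X U}) X Y"
proof -
  let ?r = "card_of {U. openin X U}"
  define \<sigma> where "\<sigma> = (\<lambda>U (h :: ('a set, 'a) play). if openin X U then U else {})"
  have "outcome ?r X p \<subseteq> Y \<or> outcome ?r X p \<inter> Y = {}"
    if lp: "legal_play ?r X p" and fo: "follows ?r \<sigma> p" for p
  proof -
    have snd: "snd (p U) = U \<or> snd (p U) = topspace X - U" if "openin X U" for U
    proof -
      have "fst (p U) = U"
        using fo that unfolding follows_def \<sigma>_def Field_card_of by simp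
      then show ?thesis using lp that unfolding legal_play_def Field_card_of by auto
    qed
    have "x = y" if xy: "x \<in> outcome ?r X p" "y \<in> outcome ?r X p" for x y
    proof (rule ccontr)
      assume "x \<noteq> y"
      then obtain U where U: "openin X U" "x \<notin> U \<longleftrightarrow> y \<in> U"
        using assms xy unfolding t0_space_def outcome_def by (metis IntD1)
      then have "x \<in> snd (p U)" "y \<in> snd (p U)"
        using xy unfolding outcome_def Field_card_of by auto
      then show False using snd[OF U(1)] U(2) by auto
    qed
    then show ?thesis by (metis disjoint_iff subsetI)
  qed
  then show ?thesis
    unfolding seeker_wins_def by (intro exI[of _ \<sigma>]) (auto simp: \<sigma>_def)
qed

lemma sm_at_wins:
  assumes "t0_space X"
  shows "Well_order (sm_at X Y)" "seeker_wins (sm_at X Y) X Y"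
  using oleast_works(1,2)[of "card_of {U. openin X U}" "\<lambda>r. seeker_wins r X Y"]
    seeker_wins_opens[OF assms] card_of_Well_order
  unfolding sm_at_def by auto

lemma sm_at_least:
  fixes t :: "'o rel"
  assumes "t0_space X" "Well_order t" "seeker_wins t X Y"
  shows "sm_at X Y \<le>o t"
  unfolding sm_at_def
proof (rule oleast_least[of "card_of {U. openin X U}"])
  show "seeker_wins s X Y" if "s =o t" for s :: "'a set rel"
    using seeker_wins_ordIso[OF ordIso_symmetric[OF that] assms(3)] .
qed (use assms in \<open>auto simp: card_of_Well_order seeker_wins_opens\<close>)

lemma sm_at_bound:
  assumes "t0_space X"
  shows "sm_at X Y \<le>o card_of {U. openin X U}"
  by (rule sm_at_least[OF assms card_of_Well_order seeker_wins_opens[OF assms]])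

lemma sm_upper:
  assumes "t0_space X"
  shows "Well_order (sm X)" "\<And>Y. Y \<subseteq> topspace X \<Longrightarrow> sm_at X Y \<le>o sm X"
proof -
  have *: "r \<le>o card_of {U. openin X U}" if "r \<in> {sm_at X Y | Y. Y \<subseteq> topspace X}" for r
    using that sm_at_bound[OF assms] by auto
  show "Well_order (sm X)"
    unfolding sm_def by (rule osup_upper(1)[OF card_of_Well_order *])
  show "sm_at X Y \<le>o sm X" if "Y \<subseteq> topspace X" for Y
    unfolding sm_def by (rule osup_upper(2)[OF card_of_Well_order *]) (use that in auto)
qed

lemma sm_least:
  fixes t :: "'o rel"
  assumes "t0_space X" "Well_order t" "\<And>Y. Y \<subseteq> topspace X \<Longrightarrow> sm_at X Y \<le>o t"
  shows "sm X \<le>o t"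
  unfolding sm_def
  by (rule osup_least[OF card_of_Well_order]) (use sm_at_bound[OF assms(1)] assms in auto)

lemma sm_bound:
  assumes "t0_space (X :: 'a topology)"
  shows "sm X \<le>o card_of (UNIV :: 'a set set)"
proof -
  have "sm_at X Y \<le>o card_of (UNIV :: 'a set set)" for Y
    by (rule ordLeq_transitive[OF sm_at_bound[OF assms] card_of_mono1]) simp
  then show ?thesis by (intro sm_least[OF assms card_of_Well_order])
qed

lemma sup_sm_upper:
  fixes X :: "'i \<Rightarrow> 'a topology"
  assumes "\<And>i. i \<in> I \<Longrightarrow> t0_space (X i)"
  shows "Well_order (osup ((\<lambda>i. sm (X i)) ` I))"
    "\<And>i. i \<in> I \<Longrightarrow> sm (X i) \<le>o osup ((\<lambda>i. sm (X i)) ` I)"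
proof -
  have *: "r \<le>o card_of (UNIV :: 'a set set)" if "r \<in> (\<lambda>i. sm (X i)) ` I" for r
    using that sm_bound[OF assms] by auto
  show "Well_order (osup ((\<lambda>i. sm (X i)) ` I))"
    by (rule osup_upper(1)[OF card_of_Well_order *])
  show "sm (X i) \<le>o osup ((\<lambda>i. sm (X i)) ` I)" if "i \<in> I" for i
    by (rule osup_upper(2)[OF card_of_Well_order *]) (use that in auto)
qed

lemma sup_sm_least:
  fixes t :: "'o rel"
  assumes "\<And>i. i \<in> I \<Longrightarrow> t0_space (X i)"
    and "Well_order t" "\<And>i. i \<in> I \<Longrightarrow> sm (X i) \<le>o t"
  shows "osup ((\<lambda>i. sm (X i)) ` I) \<le>o t"
  by (rule osup_least[OF card_of_Well_order]) (use sm_bound[OF assms(1)] assms in auto)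

end

theory Submission
  imports Defs
begin

text \<open>
  The Seeker first plays winning strategies for the traces of \<open>Y\<close> on all summands at once: an open
  set of the sum is just a family of open sets, and the Hider's answer on the sum is an answer on
  every summand. After \<open>sup sm (X i)\<close> moves the part of the outcome in each summand lies inside
  \<open>Y\<close> or misses \<open>Y\<close>. The extra move is the union of the summands of the first kind, which is open.
\<close>

lemma Field_osum: "Field (r \<oplus>o s) = Inl ` Field r \<union> Inr ` Field s"
proof
  show "Field (r \<oplus>o s) \<subseteq> Inl ` Field r \<union> Inr ` Field s"
    unfolding osum_def by (auto simp: Field_def)
  have "Inl a \<in> Field (r \<oplus>o s)" if "a \<in> Field r" for a
    using that unfolding Field_def[of r] osum_def by (blast intro: FieldI1 FieldI2)
  moreover have "Inr b \<in> Field (r \<oplus>o s)" if "b \<in> Field s" for b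
    using that unfolding Field_def[of s] osum_def by (blast intro: FieldI1 FieldI2)
  ultimately show "Inl ` Field r \<union> Inr ` Field s \<subseteq> Field (r \<oplus>o s)" by blast
qed

lemma Field_oone [simp]: "Field oone = UNIV"
  unfolding oone_def Field_def by auto

lemma underS_osum_Inl: "underS (r \<oplus>o s) (Inl a) = Inl ` underS r a"
  unfolding underS_def osum_def by auto

lemma underS_osum_Inr:
  assumes "b \<in> Field s"
  shows "underS (r \<oplus>o s) (Inr b) = Inl ` Field r \<union> Inr ` underS s b"
  using assms unfolding underS_def osum_def by auto

lemma Well_order_oone: "Well_order oone"
  unfolding oone_def by (simp add: well_order_on_def order_on_defs refl_on_def trans_def
      antisym_def total_on_def Field_def)

lemma Well_order_osum:
  assumes r: "Well_order r" and s: "Well_order s"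
  shows "Well_order (r \<oplus>o s)"
proof -
  have "refl_on (Field (r \<oplus>o s)) (r \<oplus>o s)"
  proof -
    have "Refl r" "Refl s" using r s by (auto simp: well_order_on_def order_on_defs)
    then show ?thesis unfolding refl_on_def Field_osum by (auto simp: osum_def)
  qed
  moreover have "trans (r \<oplus>o s)"
  proof -
    have "trans r" "trans s" using r s by (auto simp: well_order_on_def order_on_defs)
    then show ?thesis
      unfolding osum_def trans_def Field_def by blast
  qed
  moreover have "antisym (r \<oplus>o s)"
    using r s by (auto simp: osum_def well_order_on_def order_on_defs antisym_def)
  moreover have "total_on (Field (r \<oplus>o s)) (r \<oplus>o s)"
  proof -
    have "Total r" "Total s" using r s by (auto simp: well_order_on_def order_on_defs)
    then show ?thesis
      unfolding total_on_def Field_osum by (fastforce simp: osum_def)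
  qed
  moreover have "wf (r \<oplus>o s - Id)"
  proof (rule wfI_min)
    fix x :: "'a + 'b" and Q assume x: "x \<in> Q"
    have wf: "wf (r - Id)" "wf (s - Id)" using r s by (auto simp: well_order_on_def)
    show "\<exists>z\<in>Q. \<forall>y. (y, z) \<in> r \<oplus>o s - Id \<longrightarrow> y \<notin> Q"
    \<comment> \<open>Left elements precede all right ones, so a minimum of \<open>Q\<close> is
      sought among its left elements whenever there are any.\<close>
    proof (cases "\<exists>a. Inl a \<in> Q")
      case True
      then obtain a where a: "a \<in> Inl -` Q" by blast
      then obtain z where "z \<in> Inl -` Q" "\<And>y. (y, z) \<in> r - Id \<Longrightarrow> y \<notin> Inl -` Q"
        using wfE_min[OF wf(1) a] by blast
      then show ?thesis by (intro bexI[of _ "Inl z"]) (auto simp: osum_def)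
    next
      case False
      with x obtain b where b: "b \<in> Inr -` Q" by (cases x) auto
      then obtain z where "z \<in> Inr -` Q" "\<And>y. (y, z) \<in> s - Id \<Longrightarrow> y \<notin> Inr -` Q"
        using wfE_min[OF wf(2) b] by blast
      with False show ?thesis by (intro bexI[of _ "Inr z"]) (auto simp: osum_def)
    qed
  qed
  ultimately show ?thesis
    by (auto simp: well_order_on_def order_on_defs intro: FieldI1 FieldI2)
qed

lemma t0_space_sum_topology:
  assumes "\<And>i. i \<in> I \<Longrightarrow> t0_space (X i)"
  shows "t0_space (sum_topology X I)"
  unfolding t0_space_def
proof (intro ballI impI)
  fix u v assume uv: "u \<in> topspace (sum_topology X I)" "v \<in> topspace (sum_topology X I)" "u \<noteq> v"
  obtain i x j y where "u = (i, x)" "v = (j, y)" by (metis surj_pair)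
  with uv have u: "u = (i, x)" "i \<in> I" "x \<in> topspace (X i)"
    and v: "v = (j, y)" "j \<in> I" "y \<in> topspace (X j)"
    by auto
  show "\<exists>U. openin (sum_topology X I) U \<and> (u \<notin> U) = (v \<in> U)"
  proof (cases "i = j")
    case True
    then obtain U where "openin (X i) U" "x \<notin> U \<longleftrightarrow> y \<in> U"
      using assms[OF u(2)] u v uv(3) unfolding t0_space_def by blast
    \<comment> \<open>A separating set inside one summand stays open in the sum when every other
      fibre is left empty.\<close>
    with True u v show ?thesis
      by (intro exI[of _ "Sigma I (\<lambda>k. if k = i then U else {})"])
        (auto simp: openin_disjoint_union)
  next
    case False
    \<comment> \<open>Points of different summands are separated by a whole summand.\<close>
    with u v show ?thesis
      by (intro exI[of _ "Sigma I (\<lambda>k. if k = i then topspace (X i) else {})"])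
        (auto simp: openin_disjoint_union)
  qed
qed

text \<open>After the moves in \<open>A\<close> the game is already decided: later moves only shrink
  the outcome, and both winning conditions pass to subsets. So the same strategy serves, whatever
  open sets it proposes outside \<open>A\<close>.\<close>

lemma seeker_wins_initial:
  assumes t: "Well_order t" and A: "wo_rel.ofilter t A" and win: "seeker_wins (Restr t A) X Y"
  shows "seeker_wins t X Y"
proof -
  have wo: "wo_rel t" using t by (simp add: wo_rel_def)
  have F: "Field (Restr t A) = A" using Field_Restr_ofilter[OF t A] .
  have sub: "A \<subseteq> Field t" and down: "\<And>a. a \<in> A \<Longrightarrow> underS t a \<subseteq> A"
    using A unfolding wo_rel.ofilter_def[OF wo] under_def underS_def by auto
  \<comment> \<open>Since \<open>A\<close> is downward closed, a move in \<open>A\<close> has the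
    same record of previous moves in both games.\<close>
  have S: "underS (Restr t A) a = underS t a" if "a \<in> A" for a
    using down[OF that] that unfolding underS_def by auto
  obtain \<sigma> where op: "\<And>a h. openin X (\<sigma> a h)"
    and win: "\<And>p. legal_play (Restr t A) X p \<Longrightarrow> follows (Restr t A) \<sigma> p \<Longrightarrow>
               outcome (Restr t A) X p \<subseteq> Y \<or> outcome (Restr t A) X p \<inter> Y = {}"
    using win unfolding seeker_wins_def by blast
  have "outcome t X p \<subseteq> Y \<or> outcome t X p \<inter> Y = {}"
    if lp: "legal_play t X p" and fo: "follows t \<sigma> p" for p
  proof -
    have "legal_play (Restr t A) X p"
      using lp sub unfolding legal_play_def F by blast
    moreover have "follows (Restr t A) \<sigma> p"
      using fo sub unfolding follows_def F by (auto simp: S)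
    moreover have "outcome t X p \<subseteq> outcome (Restr t A) X p"
      using sub unfolding outcome_def F by blast
    ultimately show ?thesis using win by blast
  qed
  then show ?thesis unfolding seeker_wins_def using op by blast
qed

text \<open>Used to bring the games on all summands to one common length, so that they can be played
  simultaneously. A strictly smaller ordinal is isomorphic to a proper initial segment of
  \<open>t\<close>, which reduces the claim to \<open>seeker_wins_initial\<close>.\<close>

lemma seeker_wins_mono:
  assumes "r \<le>o t" and "seeker_wins r X Y"
  shows "seeker_wins t X Y"
proof -
  have wo: "Well_order r" "Well_order t" using assms(1) unfolding ordLeq_def by auto
  consider "r =o t" | "r <o t" using assms(1) ordLeq_iff_ordLess_or_ordIso by blast
  then show ?thesis
  proof cases
    case 1
    then show ?thesis using seeker_wins_ordIso assms(2) by blast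
  next
    case 2
    then obtain a where "r =o Restr t (underS t a)"
      using ordLess_iff_ordIso_Restr[OF wo(2,1)] by blast
    moreover have "wo_rel.ofilter t (underS t a)"
      using wo(2) by (simp add: wo_rel_def wo_rel.underS_ofilter)
    ultimately show ?thesis
      using seeker_wins_initial[OF wo(2)] seeker_wins_ordIso assms(2) by blast
  qed
qed

lemma seeker_wins_sum_topology:
  fixes X :: "'i \<Rightarrow> 'a topology" and r :: "'o rel"
  assumes "\<And>i. i \<in> I \<Longrightarrow> seeker_wins r (X i) {x. (i, x) \<in> Y}"
  shows "seeker_wins (r \<oplus>o oone) (sum_topology X I) Y"
proof -
  let ?S = "sum_topology X I"
  have "\<forall>i\<in>I. \<exists>\<sigma>. (\<forall>a h. openin (X i) (\<sigma> a h)) \<and>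
          (\<forall>p. legal_play r (X i) p \<and> follows r \<sigma> p \<longrightarrow>
             outcome r (X i) p \<subseteq> {x. (i, x) \<in> Y} \<or> outcome r (X i) p \<inter> {x. (i, x) \<in> Y} = {})"
    using assms unfolding seeker_wins_def by blast
  from bchoice[OF this] obtain \<sigma> where op: "\<And>i a h. i \<in> I \<Longrightarrow> openin (X i) (\<sigma> i a h)"
    and win: "\<And>i p. i \<in> I \<Longrightarrow> legal_play r (X i) p \<Longrightarrow> follows r (\<sigma> i) p \<Longrightarrow>
             outcome r (X i) p \<subseteq> {x. (i, x) \<in> Y} \<or> outcome r (X i) p \<inter> {x. (i, x) \<in> Y} = {}"
    by blast
  \<comment> \<open>The play seen from summand \<open>i\<close>: the fibres over \<open>i\<close> of
    the Seeker's choice and of the Hider's answer, with the extra move dropped.\<close>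
  define slice :: "'i \<Rightarrow> ('o + unit, 'i \<times> 'a) play \<Rightarrow> ('o, 'a) play"
    where "slice = (\<lambda>i h a. map_prod ((-`) (Pair i)) ((-`) (Pair i)) (h (Inl a)))"
  define good where "good = (\<lambda>i h. outcome r (X i) (slice i h) \<subseteq> {x. (i, x) \<in> Y})"
  \<comment> \<open>The inner \<open>restrict\<close> matters: \<open>slice i\<close> need not turn
    an \<open>undefined\<close> entry of the record into \<open>undefined\<close>, so the entries
    off \<open>underS r a\<close> are reset to give a proper record for
    \<open>\<sigma> i\<close>.\<close>
  define \<tau> :: "('o + unit, 'i \<times> 'a) strategy" where
    "\<tau> = (\<lambda>b h. Sigma I (\<lambda>i. case b of
              Inl a \<Rightarrow> \<sigma> i a (restrict (slice i h) (underS r a))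
            | Inr _ \<Rightarrow> if good i h then topspace (X i) else {}))"
  have "openin ?S (\<tau> b h)" for b h
    unfolding \<tau>_def by (auto simp: openin_disjoint_union op split: sum.split)
  moreover have "outcome (r \<oplus>o oone) ?S p \<subseteq> Y \<or> outcome (r \<oplus>o oone) ?S p \<inter> Y = {}"
    if lp: "legal_play (r \<oplus>o oone) ?S p" and fo: "follows (r \<oplus>o oone) \<tau> p" for p
  proof -
    have lpl: "snd (p (Inl a)) = fst (p (Inl a)) \<or> snd (p (Inl a)) = topspace ?S - fst (p (Inl a))"
      if "a \<in> Field r" for a
      using lp that unfolding legal_play_def Field_osum by auto
    have fol: "fst (p (Inl a)) = \<tau> (Inl a) (restrict p (Inl ` underS r a))" if "a \<in> Field r" for a
      using fo that unfolding follows_def Field_osum by (auto simp: underS_osum_Inl)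
    have S1: "underS oone () = {}" unfolding underS_def by auto
    have last: "fst (p (Inr ())) = \<tau> (Inr ()) (restrict p (Inl ` Field r))"
      using fo unfolding follows_def Field_osum by (auto simp: underS_osum_Inr S1)
    have lplast: "snd (p (Inr ())) = fst (p (Inr ())) \<or>
        snd (p (Inr ())) = topspace ?S - fst (p (Inr ()))"
      using lp unfolding legal_play_def Field_osum by auto
    \<comment> \<open>The extra move comes after every \<open>Inl a\<close> with \<open>a\<close> in
      \<open>Field r\<close>, and \<open>good\<close> reads only those moves. Hence the Seeker
      evaluates it correctly from the record.\<close>
    have good: "good i (restrict p (Inl ` Field r)) = good i p" for i
      unfolding good_def outcome_def slice_def by simp
    have res: "restrict (slice i (restrict p (Inl ` underS r a))) (underS r a)
        = restrict (slice i p) (underS r a)" for i a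
      unfolding slice_def by (auto simp: restrict_def fun_eq_iff)
    have dich: "good i p \<or> outcome r (X i) (slice i p) \<inter> {x. (i, x) \<in> Y} = {}" if i: "i \<in> I" for i
    proof -
      have f: "fst (slice i p a) = \<sigma> i a (restrict (slice i p) (underS r a))"
        if "a \<in> Field r" for a
      proof -
        have "fst (slice i p a) = Pair i -` fst (p (Inl a))" unfolding slice_def by simp
        also have "\<dots> = \<sigma> i a (restrict (slice i p) (underS r a))"
          using i unfolding fol[OF that] \<tau>_def by (simp add: res vimage_def)
        finally show ?thesis .
      qed
      then have "follows r (\<sigma> i) (slice i p)" unfolding follows_def by blast
      moreover have "legal_play r (X i) (slice i p)"
        unfolding legal_play_def
      proof (intro ballI conjI)
        fix a assume a: "a \<in> Field r"
        show "openin (X i) (fst (slice i p a))" unfolding f[OF a] using op[OF i] .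
        \<comment> \<open>Taking the fibre over \<open>i\<close> commutes with complements, and the
          fibre of the whole sum is \<open>topspace (X i)\<close>. So each answer of the Hider is
          legal in every summand.\<close>
        show "snd (slice i p a) \<in> {fst (slice i p a), topspace (X i) - fst (slice i p a)}"
          using lpl[OF a] i unfolding slice_def by auto
      qed
      ultimately show ?thesis using win[OF i] unfolding good_def by blast
    qed
    have out: "i \<in> I \<and> x \<in> outcome r (X i) (slice i p) \<and> (i, x) \<in> snd (p (Inr ()))"
      if "(i, x) \<in> outcome (r \<oplus>o oone) ?S p" for i x
      using that unfolding outcome_def slice_def Field_osum by auto
    have L: "fst (p (Inr ())) = Sigma I (\<lambda>i. if good i p then topspace (X i) else {})"
      unfolding last \<tau>_def by (simp add: good)
    from lplast show ?thesis
    proof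
      \<comment> \<open>Accepting the extra move leaves only points of good summands, whose slice
        outcomes lie in \<open>Y\<close>.\<close>
      assume e: "snd (p (Inr ())) = fst (p (Inr ()))"
      have "(i, x) \<in> Y" if "(i, x) \<in> outcome (r \<oplus>o oone) ?S p" for i x
      proof -
        have "good i p" using out[OF that] unfolding e L by (auto split: if_splits)
        then show ?thesis using out[OF that] unfolding good_def by blast
      qed
      then show ?thesis by auto
    next
      \<comment> \<open>Rejecting it leaves only points of summands that are not good, where
        \<open>dich\<close> makes the outcome miss \<open>Y\<close>.\<close>
      assume e: "snd (p (Inr ())) = topspace ?S - fst (p (Inr ()))"
      have "(i, x) \<notin> Y" if "(i, x) \<in> outcome (r \<oplus>o oone) ?S p" for i x
      proof -
        have "\<not> good i p" using out[OF that] unfolding e L by auto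
        then show ?thesis using out[OF that] dich[of i] by blast
      qed
      then show ?thesis by auto
    qed
  qed
  ultimately show ?thesis unfolding seeker_wins_def by (intro exI[of _ \<tau>]) simp
qed

theorem theorem3p4:
  fixes X :: "'i \<Rightarrow> 'a topology" and I :: "'i set"
  assumes "\<And>i. i \<in> I \<Longrightarrow> t0_space (X i)"
  shows "sm (sum_topology X I) \<le>o osup ((\<lambda>i. sm (X i)) ` I) \<oplus>o oone"
proof -
  let ?k = "osup ((\<lambda>i. sm (X i)) ` I)"
  have t0: "t0_space (sum_topology X I)" by (rule t0_space_sum_topology[OF assms])
  have wo: "Well_order (?k \<oplus>o oone)"
    by (rule Well_order_osum[OF sup_sm_upper(1)[OF assms] Well_order_oone])
  show ?thesis
  proof (rule sm_least[OF t0 wo], rule sm_at_least[OF t0 wo], rule seeker_wins_sum_topology)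
    fix Y i assume Y: "Y \<subseteq> topspace (sum_topology X I)" and i: "i \<in> I"
    have "{x. (i, x) \<in> Y} \<subseteq> topspace (X i)" using Y by auto
    \<comment> \<open>The optimal length for the trace of \<open>Y\<close> depends on
      \<open>i\<close>; bounding it by the supremum lets \<open>seeker_wins_mono\<close> stretch
      each winning strategy to the common length \<open>?k\<close>.\<close>
    then have "sm_at (X i) {x. (i, x) \<in> Y} \<le>o ?k"
      using sm_upper(2)[OF assms[OF i]] sup_sm_upper(2)[of I X, OF assms i] ordLeq_transitive
      by blast
    then show "seeker_wins ?k (X i) {x. (i, x) \<in> Y}"
      using seeker_wins_mono sm_at_wins(2)[OF assms[OF i]] by blast
  qed
qed

end
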